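(* Let $a,b\in\mathbb{R}^n$ with $a_i>1$ and $b_i>1$ for all $i\in\{1,\dots,n\}$, and let $p\in\mathbb{R}$ with $p<0$. Assume $a\prec^w b$. Then $$\sum_{i=1}^n(\log a_i)^p\ \le\ \sum_{i=1}^n(\log b_i)^p .$$
   Context: For $x\in\mathbb{R}^n$, $x_1^\uparrow\le x_2^\uparrow\le\dots\le x_n^\uparrow$ denote the components of $x$ arranged in ascending order. For vectors $x,y$ with positive components, $x\prec^w y$ ($x$ is weakly majorized by $y$ from above) means $\sum_{i=1}^k x_i^\uparrow\ge\sum_{i=1}^k y_i^\uparrow$ for all $k\in\{1,\dots,n\}$. $\log$ is the natural logarithm. *)

theory Defs
  imports "HOL-Analysis.Analysis"
begin

definition ascending_list :: "real ^ 'n \<Rightarrow> real list" where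
  "ascending_list x = sorted_list_of_multiset (image_mset (\<lambda>i. x $ i) (mset_set UNIV))"

text \<open>The index is 1-based as in the usual notation \<open>x\<^sub>1\<^sup>\<up> \<le> \<dots> \<le> x\<^sub>n\<^sup>\<up>\<close>;
  only the values for \<open>1 \<le> i \<le> n\<close> with \<open>n = CARD('n)\<close> are meaningful.\<close>

definition ascending :: "real ^ 'n \<Rightarrow> nat \<Rightarrow> real" where
  "ascending x i = ascending_list x ! (i - 1)"

text \<open>Weak majorization from above. The notion is meant for vectors with positive components,
  but the formula makes sense for all real vectors, so positivity is not built in.\<close>

definition weakly_majorized_above :: "real ^ 'n \<Rightarrow> real ^ 'n \<Rightarrow> bool"
    (infix "\<prec>\<^sup>w" 50) where
  "x \<prec>\<^sup>w y \<longleftrightarrow>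
    (\<forall>k\<in>{1..CARD('n)}. (\<Sum>i=1..k. ascending x i) \<ge> (\<Sum>i=1..k. ascending y i))"

lemma mset_ascending_list: "mset (ascending_list x) = image_mset (\<lambda>i. x $ i) (mset_set UNIV)"
  by (simp add: ascending_list_def)

lemma length_ascending_list: "length (ascending_list (x :: real ^ 'n)) = CARD('n)"
  by (metis mset_ascending_list size_image_mset size_mset size_mset_set)

lemma sorted_ascending_list: "sorted (ascending_list x)"
  by (simp add: ascending_list_def)

lemma ascending_mono:
  fixes x :: "real ^ 'n"
  assumes "1 \<le> i" "i \<le> j" "j \<le> CARD('n)"
  shows "ascending x i \<le> ascending x j"
  unfolding ascending_def
  using assms by (intro sorted_nth_mono sorted_ascending_list) (auto simp: length_ascending_list)

end

theory Submission
  imports Defs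
begin

text \<open>
  The function \<open>f x = (ln x) powr p\<close> is decreasing and convex on \<open>x > 1\<close>. Comparing \<open>f\<close> with its
  tangents at the ordered components of \<open>a\<close> bounds the difference of the two sums from below
  by \<open>\<Sum>i. c i * (a i - b i)\<close>, where the slopes \<open>c i = - f' (a i)\<close> are nonnegative and nonincreasing
  in \<open>i\<close>. Summation by parts expresses this through the partial sums of \<open>a i - b i\<close>, which are
  nonnegative by majorization.
\<close>

text \<open>Abel summation by induction. The lower bound keeps \<open>c n\<close> times the full sum
  instead of 0, so that the step can add \<open>c (Suc n) * d (Suc n)\<close> to both sides.\<close>

lemma sum_mult_antimono_ge:
  fixes c d :: "nat \<Rightarrow> real"
  assumes "\<And>i. 1 \<le> i \<Longrightarrow> i < n \<Longrightarrow> c (Suc i) \<le> c i"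
    and "\<And>k. 1 \<le> k \<Longrightarrow> k \<le> n \<Longrightarrow> 0 \<le> (\<Sum>i=1..k. d i)"
  shows "c n * (\<Sum>i=1..n. d i) \<le> (\<Sum>i=1..n. c i * d i)"
  using assms
proof (induction n)
  case 0
  then show ?case by simp
next
  case (Suc n)
  have "c (Suc n) * (\<Sum>i=1..n. d i) \<le> c n * (\<Sum>i=1..n. d i)"
    using Suc.prems(1)[of n] Suc.prems(2)[of n] by (cases "n = 0") (auto intro!: mult_right_mono)
  also have "\<dots> \<le> (\<Sum>i=1..n. c i * d i)"
    using Suc.prems by (intro Suc.IH) auto
  finally show ?case by (simp add: distrib_left)
qed

text \<open>Sorting only permutes the components, so both sides sum \<open>f\<close> over one
  multiset.\<close>

lemma sum_ascending:
  fixes x :: "real ^ 'n" and f :: "real \<Rightarrow> real"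
  shows "(\<Sum>i=1..CARD('n). f (ascending x i)) = (\<Sum>i\<in>UNIV. f (x $ i))"
proof -
  let ?n = "CARD('n)"
  have "(\<Sum>i\<in>UNIV. f (x $ i)) = sum_mset (image_mset f (mset (ascending_list x)))"
    by (simp add: mset_ascending_list sum_unfold_sum_mset image_mset.compositionality o_def)
  also have "\<dots> = sum_list (map f (ascending_list x))"
    by (metis mset_map sum_mset_sum_list)
  also have "\<dots> = (\<Sum>i<?n. f (ascending_list x ! i))"
    by (simp add: sum_list_sum_nth length_ascending_list atLeast0LessThan)
  also have "\<dots> = (\<Sum>i=1..?n. f (ascending x i))"
    by (rule sum.reindex_bij_witness[of _ "\<lambda>i. i - 1" Suc]) (auto simp: ascending_def)
  finally show ?thesis by simp
qed

lemma ascending_in_range: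
  fixes x :: "real ^ 'n"
  assumes "i \<in> {1..CARD('n)}"
  shows "ascending x i \<in> range (($) x)"
proof -
  have "ascending x i \<in> set (ascending_list x)"
    using assms by (auto simp: ascending_def length_ascending_list intro!: nth_mem)
  also have "\<dots> = range (($) x)"
    by (metis mset_ascending_list set_mset_mset set_image_mset finite_set_mset_mset_set finite)
  finally show ?thesis .
qed

text \<open>The Tomic-Weyl variant of Karamata's inequality, for decreasing convex \<open>f\<close>
  on an open interval \<open>S\<close>.\<close>

lemma sum_le_of_weakly_majorized_above:
  fixes a b :: "real ^ 'n" and f f' :: "real \<Rightarrow> real"
  assumes S: "open S" "connected S" "convex_on S f"
    and deriv: "\<And>x. x \<in> S \<Longrightarrow> (f has_real_derivative f' x) (at x)"
    and mono: "mono_on S f'"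
    and nonpos: "\<And>x. x \<in> S \<Longrightarrow> f' x \<le> 0"
    and a: "\<And>i. a $ i \<in> S" and b: "\<And>i. b $ i \<in> S"
    and maj: "a \<prec>\<^sup>w b"
  shows "(\<Sum>i\<in>UNIV. f (a $ i)) \<le> (\<Sum>i\<in>UNIV. f (b $ i))"
proof -
  let ?n = "CARD('n)"
  let ?d = "\<lambda>i. ascending a i - ascending b i"
  have aS: "ascending a i \<in> S" and bS: "ascending b i \<in> S" if "i \<in> {1..?n}" for i
    using ascending_in_range[OF that, of a] ascending_in_range[OF that, of b] a b by auto
  have partial: "0 \<le> (\<Sum>i=1..k. ?d i)" if "1 \<le> k" "k \<le> ?n" for k
    using maj that by (auto simp: weakly_majorized_above_def sum_subtractf)
  \<comment> \<open>The total of the differences may be positive, unlike in ordinary majorization;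
    \<open>f' \<le> 0\<close> at the largest component of \<open>a\<close> handles this boundary
    term.\<close>
  have "0 \<le> - f' (ascending a ?n) * (\<Sum>i=1..?n. ?d i)"
    using partial[of ?n] nonpos[OF aS[of ?n]]
    by (intro mult_nonneg_nonneg) (auto simp: Suc_le_eq)
  also have "\<dots> \<le> (\<Sum>i=1..?n. - f' (ascending a i) * ?d i)"
    using partial
    by (intro sum_mult_antimono_ge) (auto intro!: mono_onD[OF mono] aS ascending_mono)
  also have "\<dots> \<le> (\<Sum>i=1..?n. f (ascending b i) - f (ascending a i))"
  proof (rule sum_mono)
    fix i assume i: "i \<in> {1..?n}"
    have "f (ascending b i) - f (ascending a i) \<ge> f' (ascending a i) * (ascending b i - ascending a i)"
      using S aS[OF i] bS[OF i]
      by (intro convex_on_imp_above_tangent[of S])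
         (auto simp: interior_open intro: has_field_derivative_at_within deriv)
    then show "- f' (ascending a i) * ?d i \<le> f (ascending b i) - f (ascending a i)"
      by (simp add: algebra_simps)
  qed
  finally show ?thesis
    unfolding sum_subtractf sum_ascending by simp
qed

theorem theorem3p4:
  fixes a b :: "real ^ 'n" and p :: real
  assumes "\<And>i. a $ i > 1" and "\<And>i. b $ i > 1"
    and "p < 0"
    and "a \<prec>\<^sup>w b"
  shows "(\<Sum>i\<in>UNIV. (ln (a $ i)) powr p) \<le> (\<Sum>i\<in>UNIV. (ln (b $ i)) powr p)"
proof -
  define f' :: "real \<Rightarrow> real" where "f' x = p * (ln x powr (p - 1) / x)" for x
  have deriv: "((\<lambda>x. ln x powr p) has_real_derivative f' x) (at x)" if "x > 1" for x
    unfolding f'_def using that by (auto intro!: derivative_eq_intros simp: powr_diff field_simps)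
  \<comment> \<open>This serves twice: for convexity and for the order of the tangent
    slopes.\<close>
  have mono: "f' x \<le> f' y" if "1 < x" "x \<le> y" for x y
  proof -
    \<comment> \<open>Since \<open>p - 1 < 0\<close>, the numerator decreases while the denominator
      grows; the factor \<open>p < 0\<close> then reverses the inequality.\<close>
    have "ln y powr (p - 1) / y \<le> ln x powr (p - 1) / x"
      using that \<open>p < 0\<close> by (intro frac_le powr_mono2') auto
    then show ?thesis
      using \<open>p < 0\<close> unfolding f'_def by (intro mult_left_mono_neg) auto
  qed
  have nonpos: "f' x \<le> 0" if "x > 1" for x
    unfolding f'_def using that \<open>p < 0\<close> by (intro mult_nonpos_nonneg) auto
  have "convex_on {1<..} (\<lambda>x. ln x powr p)"
    by (rule convex_on_realI[where f' = f']) (auto intro: deriv mono)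
  then show ?thesis
    using assms
    by (intro sum_le_of_weakly_majorized_above[of "{1<..}" _ f'])
       (auto intro!: deriv mono nonpos mono_onI)
qed

end
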